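(* Suppose $a\ge1$ and $$0<\alpha_1\le\alpha_2\le\dots\le\alpha_p,\qquad 0<\beta_1\le\beta_2\le\dots\le\beta_p,\qquad \sum_{j=1}^k\alpha_j\le\sum_{j=1}^k\beta_j\ \text{ for } k=1,\dots,p.$$ For $x>0$ define $$\widehat W(x)=\prod_{j=1}^p\frac{\Gamma(x/\alpha_j+a)^{\alpha_j}}{\Gamma(x/\beta_j+a)^{\beta_j}},\qquad \widehat V(x)=\prod_{j=1}^p\frac{\Gamma(x/\alpha_j+a)^{\alpha_j}\,\alpha_j^x}{\Gamma(x/\beta_j+a)^{\beta_j}\,\beta_j^x}.$$ Then $(\log\widehat W)'$ is a Bernstein function and $\widehat V$ is logarithmically completely monotonic.
   Context: $\Gamma$ is Euler's gamma function. A function $f:(0,\infty)\to\mathbb R$ is completely monotonic if it is infinitely differentiable, $f\ge0$, and $(-1)^nf^{(n)}(x)\ge0$ for all $n\ge1$, $x>0$. A Bernstein function is an infinitely differentiable function $g:(0,\infty)\to[0,\infty)$ such that $g'$ is completely monotonic. A positive function $f$ on $(0,\infty)$ is logarithmically completely monotonic if $-(\log f)'$ is completely monotonic. *)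

theory Defs
  imports "HOL-Analysis.Analysis"
begin

text \<open>
  Functions on the open half-line are modelled by total functions, of which only the values on
  \<open>{0<..}\<close> matter. As this set is open, the iterated derivatives at points \<open>x > 0\<close> do not
  depend on the values elsewhere.
\<close>

definition smooth_on_pos :: "(real \<Rightarrow> real) \<Rightarrow> bool" where
  "smooth_on_pos f \<longleftrightarrow> (\<forall>n. (deriv ^^ n) f differentiable_on {0<..})"

definition completely_monotonic :: "(real \<Rightarrow> real) \<Rightarrow> bool" where
  "completely_monotonic f \<longleftrightarrow>
     smooth_on_pos f \<and> (\<forall>x>0. 0 \<le> f x) \<and>
     (\<forall>n\<ge>1. \<forall>x>0. 0 \<le> (-1) ^ n * (deriv ^^ n) f x)"

definition bernstein_function :: "(real \<Rightarrow> real) \<Rightarrow> bool" where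
  "bernstein_function g \<longleftrightarrow>
     smooth_on_pos g \<and> (\<forall>x>0. 0 \<le> g x) \<and> completely_monotonic (deriv g)"

text \<open>
  Since \<^const>\<open>deriv\<close> is a total operator, the existence of the derivative of \<open>ln f\<close>, implicit in
  the usual definition, is demanded explicitly.
\<close>

definition log_completely_monotonic :: "(real \<Rightarrow> real) \<Rightarrow> bool" where
  "log_completely_monotonic f \<longleftrightarrow>
     (\<forall>x>0. 0 < f x) \<and> (\<lambda>x. ln (f x)) differentiable_on {0<..} \<and>
     completely_monotonic (\<lambda>x. - deriv (\<lambda>y. ln (f y)) x)"

definition W_hat :: "nat \<Rightarrow> real \<Rightarrow> (nat \<Rightarrow> real) \<Rightarrow> (nat \<Rightarrow> real) \<Rightarrow> real \<Rightarrow> real" where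
  "W_hat p a \<alpha> \<beta> x =
     (\<Prod>j=1..p. Gamma (x / \<alpha> j + a) powr \<alpha> j / Gamma (x / \<beta> j + a) powr \<beta> j)"

definition V_hat :: "nat \<Rightarrow> real \<Rightarrow> (nat \<Rightarrow> real) \<Rightarrow> (nat \<Rightarrow> real) \<Rightarrow> real \<Rightarrow> real" where
  "V_hat p a \<alpha> \<beta> x =
     (\<Prod>j=1..p. (Gamma (x / \<alpha> j + a) powr \<alpha> j * \<alpha> j powr x) /
                 (Gamma (x / \<beta> j + a) powr \<beta> j * \<beta> j powr x))"

end

theory Submission
  imports Defs "HOL-Real_Asymp.Real_Asymp"
begin

text \<open>
  Up to a power \<open>s ^ (n - 1)\<close> and the exponential \<open>exp (- x * s)\<close>, the \<open>n\<close>-th derivative of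
  \<open>x \<mapsto> Digamma (x / c + a)\<close>, for \<open>n \<ge> 1\<close>, is plus or minus the integral over \<open>s > 0\<close> of
  \<open>h (c * s)\<close>, where \<open>h u = u * exp (- a * u) / (1 - exp (- u))\<close>
  (\<open>Polygamma_scaled_eq_nn_integral\<close>). The parameter \<open>c\<close> thus enters only through the argument
  of one fixed function \<open>h\<close>, which for \<open>a \<ge> 1\<close> is decreasing and convex
  (\<open>polygamma_kernel_decreasing_convex\<close>). For such functions the hypothesis on the partial sums
  yields \<open>\<Sum>j. h (\<beta> j * s) \<le> \<Sum>j. h (\<alpha> j * s)\<close>
  (\<open>weak_majorization_convex_decreasing\<close>). Hence the derivatives of
  \<open>G = (ln W)'\<close> of all orders \<open>n \<ge> 1\<close> have the alternating signs required of a Bernstein function.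

  What remains are the signs of order zero, which follow from the monotonicity of \<open>G\<close> and its
  values at the two ends of the half-line. At \<open>0\<close> all digamma terms of \<open>G\<close> cancel, so
  \<open>G \<ge> 0\<close>. The function \<open>(ln V)'\<close> differs from \<open>G\<close> by the constant
  \<open>\<Sum>j. ln (\<alpha> j) - ln (\<beta> j)\<close>; as \<open>Digamma y - ln y\<close> tends to \<open>0\<close>, so does
  \<open>(ln V)'\<close> at infinity, and being increasing it is nowhere positive.
\<close>

section \<open>Iterated derivatives on the half-line\<close>

lemma iterated_deriv_eqI:
  fixes f :: "real \<Rightarrow> real" and F :: "nat \<Rightarrow> real \<Rightarrow> real"
  assumes "\<And>x. x > 0 \<Longrightarrow> f x = F 0 x"
    and "\<And>n x. x > 0 \<Longrightarrow> (F n has_real_derivative F (Suc n) x) (at x)"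
    and "x > 0"
  shows "(deriv ^^ n) f x = F n x"
    and "((deriv ^^ n) f has_real_derivative F (Suc n) x) (at x)"
proof -
  have transfer: "(g has_real_derivative F (Suc n) x) (at x)"
    if "\<forall>x>0. g x = F n x" "x > 0" for g n x
    by (rule has_field_derivative_transform_within_open[OF assms(2)[OF that(2)], of "{0<..}"])
      (use that in auto)
  have "\<forall>x>0. (deriv ^^ n) f x = F n x" for n
  proof (induction n)
    case 0
    then show ?case using assms(1) by simp
  next
    case (Suc n)
    then show ?case using transfer[OF Suc] by (auto intro: DERIV_imp_deriv)
  qed
  then show "(deriv ^^ n) f x = F n x"
    and "((deriv ^^ n) f has_real_derivative F (Suc n) x) (at x)"
    using assms(3) transfer by auto
qed

lemma differentiable_on_pos_realI:
  fixes f :: "real \<Rightarrow> real"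
  assumes "\<And>x. x > 0 \<Longrightarrow> (f has_real_derivative f' x) (at x)"
  shows "f differentiable_on {0<..}"
  unfolding differentiable_on_def
proof
  fix x :: real assume "x \<in> {0<..}"
  then show "f differentiable at x within {0<..}"
    by (meson assms differentiable_at_withinI greaterThan_iff real_differentiable_def)
qed

lemma smooth_on_posI:
  assumes "\<And>x. x > 0 \<Longrightarrow> f x = F 0 x"
    and "\<And>n x. x > 0 \<Longrightarrow> (F n has_real_derivative F (Suc n) x) (at x)"
  shows "smooth_on_pos f"
  unfolding smooth_on_pos_def
  using iterated_deriv_eqI(2)[of f F] assms by (blast intro: differentiable_on_pos_realI)

lemma completely_monotonicI:
  assumes "\<And>x. x > 0 \<Longrightarrow> f x = F 0 x"
    and "\<And>n x. x > 0 \<Longrightarrow> (F n has_real_derivative F (Suc n) x) (at x)"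
    and "\<And>n x. x > 0 \<Longrightarrow> 0 \<le> (-1) ^ n * F n x"
  shows "completely_monotonic f"
  unfolding completely_monotonic_def
  using smooth_on_posI[of f F] assms(1,2) assms(3)[where n = 0] assms(3) iterated_deriv_eqI(1)[of f F]
  by auto

section \<open>Weak majorization\<close>

text \<open>
  Summation by parts: as the weights decrease, each step replaces the weight of the partial sum
  collected so far by a smaller one.
\<close>

lemma sum_antimono_weights_nonneg:
  fixes c t :: "nat \<Rightarrow> real"
  assumes nonneg: "\<And>j. j \<in> {1..p} \<Longrightarrow> 0 \<le> c j"
    and antimono: "\<And>i j. i \<in> {1..p} \<Longrightarrow> j \<in> {1..p} \<Longrightarrow> i \<le> j \<Longrightarrow> c j \<le> c i"
    and partial: "\<And>k. k \<in> {1..p} \<Longrightarrow> 0 \<le> (\<Sum>j=1..k. t j)"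
  shows "0 \<le> (\<Sum>j=1..p. c j * t j)"
proof -
  have "1 \<le> k \<Longrightarrow> k \<le> p \<Longrightarrow> c k * (\<Sum>j=1..k. t j) \<le> (\<Sum>j=1..k. c j * t j)" for k
  proof (induction k)
    case 0
    then show ?case by simp
  next
    case (Suc k)
    show ?case
    proof (cases "k = 0")
      case False
      then have "c (Suc k) * (\<Sum>j=1..k. t j) \<le> c k * (\<Sum>j=1..k. t j)"
        using Suc.prems by (intro mult_right_mono antimono partial) auto
      also have "\<dots> \<le> (\<Sum>j=1..k. c j * t j)" using Suc False by simp
      finally show ?thesis by (simp add: distrib_left)
    qed simp
  qed
  note bound = this[of p]
  show ?thesis
  proof (cases "p = 0")
    case False
    then have "0 \<le> c p * (\<Sum>j=1..p. t j)" using nonneg partial by simp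
    then show ?thesis using bound False by simp
  qed simp
qed

text \<open>
  The part of the weak majorization theorem that is used below. Bounding \<open>h\<close> from below by its
  tangents at the points \<open>b j\<close> makes the difference of the two sums at least
  \<open>\<Sum>j. - h' (b j) * (b j - a j)\<close>; here the weights \<open>- h' (b j)\<close> are nonnegative and decrease
  with \<open>j\<close>, because \<open>h\<close> is decreasing and convex and the \<open>b j\<close> increase.
\<close>

lemma weak_majorization_convex_decreasing:
  fixes a b :: "nat \<Rightarrow> real" and h h' h'' :: "real \<Rightarrow> real"
  assumes deriv1: "\<And>u. u > 0 \<Longrightarrow> (h has_real_derivative h' u) (at u)"
    and deriv2: "\<And>u. u > 0 \<Longrightarrow> (h' has_real_derivative h'' u) (at u)"
    and decreasing: "\<And>u. u > 0 \<Longrightarrow> h' u \<le> 0"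
    and convex: "\<And>u. u > 0 \<Longrightarrow> 0 \<le> h'' u"
    and pos: "\<And>j. j \<in> {1..p} \<Longrightarrow> 0 < a j" "\<And>j. j \<in> {1..p} \<Longrightarrow> 0 < b j"
    and mono: "mono_on {1..p} b"
    and partial: "\<And>k. k \<in> {1..p} \<Longrightarrow> (\<Sum>j=1..k. a j) \<le> (\<Sum>j=1..k. b j)"
  shows "(\<Sum>j=1..p. h (b j)) \<le> (\<Sum>j=1..p. h (a j))"
proof -
  have tangent: "h' (b j) * (a j - b j) \<le> h (a j) - h (b j)" if "j \<in> {1..p}" for j
    by (rule f''_imp_f'[of "{0<..}" h h' h'']) (use deriv1 deriv2 convex pos that in auto)
  have slope_mono: "h' u \<le> h' v" if "0 < u" "u \<le> v" for u v
    by (rule DERIV_nonneg_imp_nondecreasing[OF that(2)])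
      (meson deriv2 convex that(1) less_le_trans)
  have "0 \<le> (\<Sum>j=1..p. - h' (b j) * (b j - a j))"
  proof (rule sum_antimono_weights_nonneg)
    show "- h' (b j) \<le> - h' (b i)" if "i \<in> {1..p}" "j \<in> {1..p}" "i \<le> j" for i j
      using slope_mono[of "b i" "b j"] pos(2)[OF that(1)] mono_onD[OF mono that] by simp
  qed (use decreasing pos partial in \<open>auto simp: sum_subtractf\<close>)
  also have "\<dots> \<le> (\<Sum>j=1..p. h (a j) - h (b j))"
    using tangent by (intro sum_mono) (auto simp: algebra_simps)
  finally show ?thesis by (simp add: sum_subtractf)
qed

section \<open>The kernel\<close>

text \<open>
  The Laplace density of the polygamma functions at \<open>z + a\<close> up to a power of the variable:
  \<open>polygamma_kernel a u = u * exp (- a * u) / (1 - exp (- u))\<close>. The factor \<open>u / (exp u - 1)\<close>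
  is kept separate because it is decreasing and convex by itself.
\<close>

definition polygamma_kernel :: "real \<Rightarrow> real \<Rightarrow> real" where
  "polygamma_kernel a u = exp (- (a - 1) * u) * (u / (exp u - 1))"

lemma polygamma_kernel_nonneg: "0 < u \<Longrightarrow> 0 \<le> polygamma_kernel a u"
  by (simp add: polygamma_kernel_def)

lemma polygamma_kernel_measurable [measurable]: "polygamma_kernel a \<in> borel_measurable borel"
  unfolding polygamma_kernel_def [abs_def] by measurable

text \<open>
  The numerator of the second derivative of \<open>u / (exp u - 1)\<close>. It vanishes at \<open>0\<close>, and its
  derivative \<open>(u - 1) * exp u + 1\<close> is nonnegative because \<open>1 - u \<le> exp (- u)\<close>.
\<close>

lemma convexity_numerator_nonneg:
  fixes u :: real
  assumes "0 \<le> u"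
  shows "0 \<le> (u - 2) * exp u + u + 2"
proof -
  have "(0 - 2) * exp 0 + 0 + 2 \<le> (u - 2) * exp u + u + (2::real)"
  proof (rule DERIV_nonneg_imp_nondecreasing[OF assms])
    fix v :: real
    have "(1 - v) * exp v \<le> exp (- v) * exp v"
      using exp_ge_add_one_self[of "- v"] by (intro mult_right_mono) auto
    then have "0 \<le> (v - 1) * exp v + 1"
      by (simp add: exp_minus algebra_simps)
    moreover have "((\<lambda>v. (v - 2) * exp v + v + 2) has_real_derivative (v - 1) * exp v + 1) (at v)"
      by (auto intro!: derivative_eq_intros simp: algebra_simps)
    ultimately show "\<exists>y. ((\<lambda>v. (v - 2) * exp v + v + 2) has_real_derivative y) (at v) \<and> 0 \<le> y"
      by blast
  qed
  then show ?thesis by simp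
qed

text \<open>
  For \<open>a \<ge> 1\<close> the kernel is a product of two nonnegative, decreasing, convex functions, and these
  properties are inherited by products.
\<close>

lemma polygamma_kernel_decreasing_convex:
  assumes "1 \<le> a"
  obtains h' h'' where
    "\<And>u. u > 0 \<Longrightarrow> (polygamma_kernel a has_real_derivative h' u) (at u)"
    "\<And>u. u > 0 \<Longrightarrow> (h' has_real_derivative h'' u) (at u)"
    "\<And>u. u > 0 \<Longrightarrow> h' u \<le> 0"
    "\<And>u. u > 0 \<Longrightarrow> 0 \<le> h'' u"
proof -
  define m where "m = a - 1"
  have m: "0 \<le> m" using assms by (simp add: m_def)
  define g where "g u = u / (exp u - 1)" for u :: real
  define g' where "g' u = (exp u - 1 - u * exp u) / (exp u - 1)^2" for u :: real
  define g'' where "g'' u = exp u * ((u - 2) * exp u + u + 2) / (exp u - 1)^3" for u :: real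
  have g1: "(g has_real_derivative g' u) (at u)" if "u > 0" for u
    unfolding g_def g'_def using that
    by (auto intro!: derivative_eq_intros simp: power2_eq_square)
  have g2: "(g' has_real_derivative g'' u) (at u)" if "u > 0" for u
  proof -
    have ne: "exp u - 1 \<noteq> 0" using that by simp
    have "((\<lambda>u. (exp u - 1 - u * exp u) / (exp u - 1)^2) has_real_derivative
        ((- u * exp u) * (exp u - 1)^2 - (exp u - 1 - u * exp u) * (2 * (exp u - 1) * exp u))
          / ((exp u - 1)^2 * (exp u - 1)^2)) (at u)"
      using ne by (auto intro!: derivative_eq_intros simp: algebra_simps)
    also have "((- u * exp u) * (exp u - 1)^2 - (exp u - 1 - u * exp u) * (2 * (exp u - 1) * exp u))
          / ((exp u - 1)^2 * (exp u - 1)^2) =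
        ((exp u - 1) * (exp u * ((u - 2) * exp u + u + 2))) / ((exp u - 1) * (exp u - 1)^3)"
      by (rule arg_cong2[where f = "(/)"]) algebra+
    also have "\<dots> = g'' u" using ne by (simp add: g''_def)
    finally show ?thesis by (simp add: g'_def [abs_def])
  qed
  have g_nonneg: "0 \<le> g u" if "u > 0" for u using that by (simp add: g_def)
  have g'_nonpos: "g' u \<le> 0" if "u > 0" for u
  proof -
    have "(1 - u) * exp u \<le> exp (- u) * exp u"
      using exp_ge_add_one_self[of "- u"] by (intro mult_right_mono) auto
    then have "exp u - 1 - u * exp u \<le> 0" by (simp add: exp_minus algebra_simps)
    then show ?thesis by (simp add: g'_def divide_nonpos_nonneg)
  qed
  have g''_nonneg: "0 \<le> g'' u" if "u > 0" for u
    using that convexity_numerator_nonneg[of u] by (simp add: g''_def)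
  define h' where "h' u = exp (- m * u) * (g' u - m * g u)" for u
  define h'' where "h'' u = exp (- m * u) * (g'' u - 2 * m * g' u + m^2 * g u)" for u
  have kernel: "polygamma_kernel a = (\<lambda>u. exp (- m * u) * g u)"
    by (simp add: fun_eq_iff polygamma_kernel_def g_def m_def)
  show thesis
  proof (rule that[of h' h''])
    fix u :: real assume u: "u > 0"
    show "(polygamma_kernel a has_real_derivative h' u) (at u)"
      unfolding kernel h'_def using g1[OF u]
      by (auto intro!: derivative_eq_intros simp: algebra_simps)
    show "(h' has_real_derivative h'' u) (at u)"
      unfolding h'_def h''_def using g1[OF u] g2[OF u]
      by (auto intro!: derivative_eq_intros simp: algebra_simps power2_eq_square)
    have "g' u - m * g u \<le> 0"
      using g'_nonpos[OF u] mult_nonneg_nonneg[OF m g_nonneg[OF u]] by linarith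
    then show "h' u \<le> 0" by (simp add: h'_def mult_nonneg_nonpos)
    have "0 \<le> g'' u - 2 * m * g' u + m^2 * g u"
      using g''_nonneg[OF u] mult_nonneg_nonpos[OF m g'_nonpos[OF u]]
        mult_nonneg_nonneg[of "m^2" "g u"] g_nonneg[OF u] by simp
    then show "0 \<le> h'' u" by (simp add: h''_def)
  qed
qed

section \<open>Polygamma functions as Laplace transforms\<close>

lemma nn_integral_power_exp:
  fixes c :: real
  assumes "0 < c"
  shows "(\<integral>\<^sup>+s. ennreal (indicator {0<..} s * (s ^ n * exp (- c * s))) \<partial>lborel)
    = ennreal (fact n / c ^ Suc n)"
proof -
  let ?f = "\<lambda>t::real. ennreal (indicator {0..} t * t powr (real (Suc n) - 1) / exp t)"
  have "ennreal (fact n) = (\<integral>\<^sup>+t. ?f t \<partial>lborel)"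
    using Gamma_conv_nn_integral_real[of "real (Suc n)"] Gamma_fact[of n, where 'a = real]
    by (simp add: add.commute)
  also have "\<dots> = ennreal c * (\<integral>\<^sup>+s. ?f (0 + c * s) \<partial>lborel)"
    using assms by (subst nn_integral_real_affine[of _ c 0]) auto
  also have "(\<integral>\<^sup>+s. ?f (0 + c * s) \<partial>lborel) =
    (\<integral>\<^sup>+s. ennreal (c ^ n) * ennreal (indicator {0<..} s * (s ^ n * exp (- c * s))) \<partial>lborel)"
    \<comment> \<open>The integrands may differ at \<open>0\<close>, where \<open>powr\<close> vanishes but \<open>0 ^ 0 = 1\<close>.\<close>
  proof (rule nn_integral_cong_AE, rule eventually_mono[OF AE_lborel_singleton[of 0]])
    fix s :: real assume "s \<noteq> 0"
    then show "?f (0 + c * s) =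
      ennreal (c ^ n) * ennreal (indicator {0<..} s * (s ^ n * exp (- c * s)))"
      using assms
      by (auto simp: indicator_def zero_le_mult_iff powr_realpow exp_minus field_simps
          power_mult_distrib simp flip: ennreal_mult)
  qed
  also have "\<dots> = ennreal (c ^ n) *
      (\<integral>\<^sup>+s. ennreal (indicator {0<..} s * (s ^ n * exp (- c * s))) \<partial>lborel)" (is "_ = _ * ?I")
    by (rule nn_integral_cmult) measurable
  finally have "ennreal (fact n) = ennreal (c ^ Suc n) * ?I"
    using assms by (simp add: ennreal_mult mult.assoc)
  then have "ennreal (1 / c ^ Suc n) * ennreal (fact n) =
      (ennreal (1 / c ^ Suc n) * ennreal (c ^ Suc n)) * ?I"
    by (simp only: mult.assoc)
  also have "ennreal (1 / c ^ Suc n) * ennreal (c ^ Suc n) = 1"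
    using assms by (subst ennreal_mult [symmetric]) auto
  finally show ?thesis using assms by (simp flip: ennreal_mult)
qed

text \<open>
  Each term of the series for the polygamma function is an Euler integral; the exponentials of
  these integrals form a geometric series. Scaling the argument by \<open>\<alpha>\<close> only rescales the argument
  of the kernel, so that for different \<open>\<alpha>\<close> the integrands can be compared pointwise.
\<close>

lemma Polygamma_scaled_eq_nn_integral:
  fixes a x \<alpha> :: real
  assumes n: "1 \<le> n" and a: "0 < a" and x: "0 \<le> x" and \<alpha>: "0 < \<alpha>"
  shows "ennreal ((-1) ^ Suc n * (Polygamma n (x / \<alpha> + a) / \<alpha> ^ n)) =
    (\<integral>\<^sup>+s. ennreal (indicator {0<..} s * (s ^ (n - 1) * exp (- x * s) * polygamma_kernel a (\<alpha> * s)))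
      \<partial>lborel)"
proof -
  define z where "z = x / \<alpha> + a"
  define c where "c k = x + (a + real k) * \<alpha>" for k
  have z: "0 < z" using a x \<alpha> by (simp add: z_def add_nonneg_pos)
  have c: "0 < c k" "c k = \<alpha> * (z + real k)" for k
    using a x \<alpha> mult_pos_pos[of "a + real k" \<alpha>] by (auto simp: c_def z_def field_simps)
  have term_eq: "\<alpha> * (fact n / c k ^ Suc n) = fact n / \<alpha> ^ n * inverse ((z + real k) ^ Suc n)" for k
    using \<alpha> by (simp add: c(2) power_mult_distrib divide_simps)
  have "(\<lambda>k. inverse ((z + real k) ^ Suc n)) sums ((-1) ^ Suc n * Polygamma n z / fact n)"
    using Polygamma_LIMSEQ[of z n] n z by simp
  then have "(\<lambda>k. fact n / \<alpha> ^ n * inverse ((z + real k) ^ Suc n)) sums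
      (fact n / \<alpha> ^ n * ((-1) ^ Suc n * Polygamma n z / fact n))"
    by (rule sums_mult)
  then have series: "(\<lambda>k. \<alpha> * (fact n / c k ^ Suc n)) sums ((-1) ^ Suc n * (Polygamma n z / \<alpha> ^ n))"
    using term_eq by (simp del: power_Suc)
  have geometric: "(\<Sum>k. ennreal (\<alpha> * (indicator {0<..} s * (s ^ n * exp (- c k * s))))) =
      ennreal (indicator {0<..} s * (s ^ (n - 1) * exp (- x * s) * polygamma_kernel a (\<alpha> * s)))" for s
  proof (cases "s > 0")
    case True
    define q where "q = exp (- (\<alpha> * s))"
    have q: "0 < q" "q < 1" using True \<alpha> by (auto simp: q_def)
    have "exp (- c k * s) = exp (- x * s - a * (\<alpha> * s)) * q ^ k" for k
      by (simp add: q_def c_def flip: exp_of_nat_mult exp_add) (simp add: algebra_simps)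
    then have terms: "\<alpha> * (indicator {0<..} s * (s ^ n * exp (- c k * s))) =
        \<alpha> * s ^ n * exp (- x * s - a * (\<alpha> * s)) * q ^ k" for k
      using True by simp
    have "(\<lambda>k. \<alpha> * s ^ n * exp (- x * s - a * (\<alpha> * s)) * q ^ k) sums
        (\<alpha> * s ^ n * exp (- x * s - a * (\<alpha> * s)) * (1 / (1 - q)))"
      using q by (intro sums_mult geometric_sums) simp
    moreover have "\<alpha> * s ^ n * exp (- x * s - a * (\<alpha> * s)) * (1 / (1 - q)) =
        s ^ (n - 1) * exp (- x * s) * polygamma_kernel a (\<alpha> * s)"
    proof -
      have "1 - q = q * (exp (\<alpha> * s) - 1)"
        by (simp add: q_def right_diff_distrib flip: exp_add)
      moreover have "exp (- x * s - a * (\<alpha> * s)) = exp (- x * s) * exp (- (a - 1) * (\<alpha> * s)) * q"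
        by (simp add: q_def flip: exp_add) (simp add: algebra_simps)
      moreover have "s ^ n = s * s ^ (n - 1)" using n by (cases n) auto
      ultimately show ?thesis using q by (simp add: polygamma_kernel_def)
    qed
    ultimately have "(\<lambda>k. \<alpha> * (indicator {0<..} s * (s ^ n * exp (- c k * s)))) sums
        (s ^ (n - 1) * exp (- x * s) * polygamma_kernel a (\<alpha> * s))"
      by (simp only: terms)
    then show ?thesis
      using True \<alpha> by (subst suminf_ennreal_eq) (auto simp: zero_le_mult_iff)
  qed simp
  have "ennreal ((-1) ^ Suc n * (Polygamma n z / \<alpha> ^ n)) = (\<Sum>k. ennreal (\<alpha> * (fact n / c k ^ Suc n)))"
  proof (rule suminf_ennreal_eq [symmetric])
    show "0 \<le> \<alpha> * (fact n / c k ^ Suc n)" for k using \<alpha> c(1)[of k] by simp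
  qed (fact series)
  also have "\<dots> = (\<Sum>k. \<integral>\<^sup>+s. ennreal (\<alpha> * (indicator {0<..} s * (s ^ n * exp (- c k * s)))) \<partial>lborel)"
  proof (rule arg_cong[where f = suminf], rule ext)
    fix k
    have "ennreal (\<alpha> * (fact n / c k ^ Suc n)) =
        ennreal \<alpha> * (\<integral>\<^sup>+s. ennreal (indicator {0<..} s * (s ^ n * exp (- c k * s))) \<partial>lborel)"
      by (simp only: nn_integral_power_exp[OF c(1)[of k]] ennreal_mult'[OF less_imp_le[OF \<alpha>]])
    also have "\<dots> = (\<integral>\<^sup>+s. ennreal \<alpha> * ennreal (indicator {0<..} s * (s ^ n * exp (- c k * s))) \<partial>lborel)"
      by (rule nn_integral_cmult [symmetric]) measurable
    finally show "ennreal (\<alpha> * (fact n / c k ^ Suc n)) =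
        (\<integral>\<^sup>+s. ennreal (\<alpha> * (indicator {0<..} s * (s ^ n * exp (- c k * s)))) \<partial>lborel)"
      using \<alpha> by (simp add: ennreal_mult')
  qed
  also have "\<dots> = (\<integral>\<^sup>+s. (\<Sum>k. ennreal (\<alpha> * (indicator {0<..} s * (s ^ n * exp (- c k * s))))) \<partial>lborel)"
    by (rule nn_integral_suminf [symmetric]) measurable
  finally show ?thesis unfolding geometric z_def .
qed

text \<open>
  Under the integral sign this is weak majorization for the scaled sequences \<open>s * \<alpha> j\<close> and
  \<open>s * \<beta> j\<close>.
\<close>

lemma sum_Polygamma_scaled_le:
  fixes a x :: real and \<alpha> \<beta> :: "nat \<Rightarrow> real"
  assumes n: "1 \<le> n" and a: "1 \<le> a" and x: "0 \<le> x"
    and pos: "\<And>j. j \<in> {1..p} \<Longrightarrow> 0 < \<alpha> j" "\<And>j. j \<in> {1..p} \<Longrightarrow> 0 < \<beta> j"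
    and mono: "mono_on {1..p} \<beta>"
    and partial: "\<And>k. k \<in> {1..p} \<Longrightarrow> (\<Sum>j=1..k. \<alpha> j) \<le> (\<Sum>j=1..k. \<beta> j)"
  shows "(\<Sum>j=1..p. (-1) ^ Suc n * (Polygamma n (x / \<beta> j + a) / \<beta> j ^ n)) \<le>
    (\<Sum>j=1..p. (-1) ^ Suc n * (Polygamma n (x / \<alpha> j + a) / \<alpha> j ^ n))"
proof -
  define w where "w s = s ^ (n - 1) * exp (- x * s)" for s :: real
  have nonneg: "0 \<le> (-1) ^ Suc n * (Polygamma n (x / c + a) / c ^ n)" if "0 < c" for c
  proof -
    have z: "0 < x / c + a" using that a x by (simp add: add_nonneg_pos)
    show ?thesis
    proof (cases "even n")
      case True
      then show ?thesis
        using Polygamma_real_even_neg[OF z, of n] n that by (simp add: divide_nonpos_pos)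
    next
      case False
      moreover have "x / c + a \<notin> \<int>\<^sub>\<le>\<^sub>0" using z by (auto elim!: nonpos_Ints_cases)
      ultimately have "0 < Polygamma n (x / c + a)" by (intro Polygamma_real_odd_pos) auto
      then show ?thesis using False that by simp
    qed
  qed
  have int_eq: "ennreal (\<Sum>j=1..p. (-1) ^ Suc n * (Polygamma n (x / \<gamma> j + a) / \<gamma> j ^ n)) =
      (\<integral>\<^sup>+s. ennreal (indicator {0<..} s * (w s * (\<Sum>j=1..p. polygamma_kernel a (\<gamma> j * s)))) \<partial>lborel)"
    if "\<forall>j\<in>{1..p}. 0 < \<gamma> j" for \<gamma> :: "nat \<Rightarrow> real"
  proof -
    have \<gamma>: "0 < \<gamma> j" if "j \<in> {1..p}" for j
      using \<open>\<forall>j\<in>{1..p}. 0 < \<gamma> j\<close> that by blast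
    have "ennreal (\<Sum>j=1..p. (-1) ^ Suc n * (Polygamma n (x / \<gamma> j + a) / \<gamma> j ^ n)) =
        (\<Sum>j=1..p. ennreal ((-1) ^ Suc n * (Polygamma n (x / \<gamma> j + a) / \<gamma> j ^ n)))"
      using nonneg \<gamma> by (subst sum_ennreal) auto
    also have "\<dots> = (\<Sum>j=1..p. \<integral>\<^sup>+s. ennreal (indicator {0<..} s *
        (w s * polygamma_kernel a (\<gamma> j * s))) \<partial>lborel)"
      unfolding w_def using n a x \<gamma> by (intro sum.cong refl Polygamma_scaled_eq_nn_integral) auto
    also have "\<dots> = (\<integral>\<^sup>+s. (\<Sum>j=1..p. ennreal (indicator {0<..} s *
        (w s * polygamma_kernel a (\<gamma> j * s)))) \<partial>lborel)"
      unfolding w_def by (rule nn_integral_sum [symmetric]) measurable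
    also have "\<dots> = (\<integral>\<^sup>+s. ennreal (indicator {0<..} s *
        (w s * (\<Sum>j=1..p. polygamma_kernel a (\<gamma> j * s)))) \<partial>lborel)"
    proof (rule nn_integral_cong)
      fix s :: real
      have "0 \<le> indicator {0<..} s * (w s * polygamma_kernel a (\<gamma> j * s))" if "j \<in> {1..p}" for j
        using polygamma_kernel_nonneg[of "\<gamma> j * s" a] \<gamma>[OF that] by (auto simp: indicator_def w_def)
      then show "(\<Sum>j=1..p. ennreal (indicator {0<..} s * (w s * polygamma_kernel a (\<gamma> j * s)))) =
          ennreal (indicator {0<..} s * (w s * (\<Sum>j=1..p. polygamma_kernel a (\<gamma> j * s))))"
        by (subst sum_ennreal) (auto simp: sum_distrib_left)
    qed
    finally show ?thesis .
  qed
  have all_pos: "\<forall>j\<in>{1..p}. 0 < \<alpha> j" "\<forall>j\<in>{1..p}. 0 < \<beta> j" using pos by auto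
  obtain h' h'' where h:
      "\<And>u. u > 0 \<Longrightarrow> (polygamma_kernel a has_real_derivative h' u) (at u)"
      "\<And>u. u > 0 \<Longrightarrow> (h' has_real_derivative h'' u) (at u)"
      "\<And>u. u > 0 \<Longrightarrow> h' u \<le> 0"
      "\<And>u. u > 0 \<Longrightarrow> 0 \<le> h'' u"
    using polygamma_kernel_decreasing_convex[OF a] by blast
  have pointwise: "(\<Sum>j=1..p. polygamma_kernel a (\<beta> j * s)) \<le> (\<Sum>j=1..p. polygamma_kernel a (\<alpha> j * s))"
    if s: "0 < s" for s
  proof (rule weak_majorization_convex_decreasing[OF h])
    show "mono_on {1..p} (\<lambda>j. \<beta> j * s)"
      using mono_onD[OF mono] s by (auto intro!: mono_onI)
  qed (use s pos partial in \<open>auto simp flip: sum_distrib_right\<close>)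
  have "ennreal (\<Sum>j=1..p. (-1) ^ Suc n * (Polygamma n (x / \<beta> j + a) / \<beta> j ^ n)) \<le>
    ennreal (\<Sum>j=1..p. (-1) ^ Suc n * (Polygamma n (x / \<alpha> j + a) / \<alpha> j ^ n))"
    unfolding int_eq[OF all_pos(1)] int_eq[OF all_pos(2)]
  proof (intro nn_integral_mono ennreal_leI)
    fix s :: real
    show "indicator {0<..} s * (w s * (\<Sum>j=1..p. polygamma_kernel a (\<beta> j * s))) \<le>
        indicator {0<..} s * (w s * (\<Sum>j=1..p. polygamma_kernel a (\<alpha> j * s)))"
      using pointwise[of s] by (auto simp: indicator_def w_def intro!: mult_left_mono)
  qed
  moreover have "0 \<le> (\<Sum>j=1..p. (-1) ^ Suc n * (Polygamma n (x / \<alpha> j + a) / \<alpha> j ^ n))"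
    using nonneg pos by (intro sum_nonneg) auto
  ultimately show ?thesis by (simp only: ennreal_le_iff)
qed

section \<open>Asymptotics of the digamma function\<close>

text \<open>
  By the mean value theorem, \<open>ln x = ln_Gamma (x + 1) - ln_Gamma x\<close> is a value of the digamma
  function between \<open>x\<close> and \<open>x + 1\<close>, and \<open>Digamma (x + 1) = Digamma x + 1 / x\<close>.
\<close>

lemma Digamma_ln_bounds:
  fixes x :: real
  assumes x: "0 < x"
  shows "ln x - 1 / x \<le> Digamma x" and "Digamma x \<le> ln x"
proof -
  have "\<exists>\<xi>>x. \<xi> < x + 1 \<and> ln_Gamma (x + 1) - ln_Gamma x = (x + 1 - x) * Digamma \<xi>"
    by (rule MVT2) (use x in \<open>auto intro!: derivative_eq_intros\<close>)
  then obtain \<xi> where \<xi>: "x < \<xi>" "\<xi> < x + 1" "ln_Gamma (x + 1) - ln_Gamma x = Digamma \<xi>" by auto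
  have "x \<notin> \<int>\<^sub>\<le>\<^sub>0" using x by (auto elim!: nonpos_Ints_cases)
  then have "Gamma (x + 1) = x * Gamma x" by (rule Gamma_plus1)
  then have "ln_Gamma (x + 1) - ln_Gamma x = ln x"
    using x Gamma_real_pos[OF x] by (simp add: ln_Gamma_real_pos ln_mult_pos)
  then have ln: "ln x = Digamma \<xi>" using \<xi> by simp
  show "Digamma x \<le> ln x" unfolding ln using x \<xi> by (intro Digamma_real_mono) auto
  have "ln x \<le> Digamma (x + 1)" unfolding ln using x \<xi> by (intro Digamma_real_mono) auto
  then show "ln x - 1 / x \<le> Digamma x" using x Digamma_plus1[of x] by simp
qed

lemma Digamma_scaled_minus_ln_tendsto:
  fixes a c :: real
  assumes c: "0 < c"
  shows "((\<lambda>x. Digamma (x / c + a) + ln c - ln x) \<longlongrightarrow> 0) at_top"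
proof -
  have y: "filterlim (\<lambda>x. x / c + a) at_top at_top"
    using c by real_asymp
  have "((\<lambda>y::real. Digamma y - ln y) \<longlongrightarrow> 0) at_top"
  proof (rule tendsto_sandwich[of "\<lambda>y. - (1 / y)" _ _ "\<lambda>_. 0"])
    show "\<forall>\<^sub>F y::real in at_top. - (1 / y) \<le> Digamma y - ln y"
      using eventually_gt_at_top[of "0::real"]
      by eventually_elim (use Digamma_ln_bounds(1) in force)
    show "\<forall>\<^sub>F y::real in at_top. Digamma y - ln y \<le> 0"
      using eventually_gt_at_top[of "0::real"]
      by eventually_elim (use Digamma_ln_bounds(2) in force)
  qed real_asymp+
  from filterlim_compose[OF this y]
  have "((\<lambda>x. Digamma (x / c + a) - ln (x / c + a)) \<longlongrightarrow> 0) at_top" .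
  moreover have "((\<lambda>x. ln (x / c + a) + ln c - ln x) \<longlongrightarrow> 0) at_top"
  proof -
    have "((\<lambda>x. ln (x / c + a) - ln x) \<longlongrightarrow> - ln c) at_top"
      using c by (real_asymp simp: ln_inverse)
    from tendsto_add[OF this tendsto_const[of "ln c"]] show ?thesis by (simp add: algebra_simps)
  qed
  ultimately have "((\<lambda>x. (Digamma (x / c + a) - ln (x / c + a)) + (ln (x / c + a) + ln c - ln x))
      \<longlongrightarrow> 0 + 0) at_top"
    by (rule tendsto_add)
  then show ?thesis by (simp add: algebra_simps)
qed

section \<open>The logarithmic derivatives\<close>

text \<open>For \<open>n = 0\<close> this is the derivative of the logarithm of \<^const>\<open>W_hat\<close>.\<close>

definition polygamma_gap :: "nat \<Rightarrow> real \<Rightarrow> (nat \<Rightarrow> real) \<Rightarrow> (nat \<Rightarrow> real) \<Rightarrow> nat \<Rightarrow> real \<Rightarrow> real" where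
  "polygamma_gap p a \<alpha> \<beta> n x =
     (\<Sum>j=1..p. Polygamma n (x / \<alpha> j + a) / \<alpha> j ^ n - Polygamma n (x / \<beta> j + a) / \<beta> j ^ n)"

context
  fixes p :: nat and a :: real and \<alpha> \<beta> :: "nat \<Rightarrow> real"
  assumes a: "1 \<le> a"
    and \<alpha>: "\<And>j. j \<in> {1..p} \<Longrightarrow> 0 < \<alpha> j"
    and \<beta>: "\<And>j. j \<in> {1..p} \<Longrightarrow> 0 < \<beta> j"
begin

lemma arg_pos:
  assumes "0 \<le> x" "j \<in> {1..p}"
  shows "0 < x / \<alpha> j + a" "0 < x / \<beta> j + a"
  using assms a \<alpha>[of j] \<beta>[of j] by (auto intro!: add_nonneg_pos)

text \<open>
  The point \<open>x = 0\<close> is included so that the value there can be compared with those at \<open>x > 0\<close>.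
\<close>

lemma polygamma_gap_has_derivative:
  assumes "0 \<le> x"
  shows "(polygamma_gap p a \<alpha> \<beta> n has_real_derivative polygamma_gap p a \<alpha> \<beta> (Suc n) x) (at x)"
proof -
  have scaled: "((\<lambda>x. Polygamma n (x / c + a) / c ^ n) has_real_derivative
      Polygamma (Suc n) (x / c + a) / c ^ Suc n) (at x)" if "0 < x / c + a" "0 < c" for c
  proof -
    have "x / c + a \<notin> \<int>\<^sub>\<le>\<^sub>0" using that by (auto elim!: nonpos_Ints_cases)
    then show ?thesis
      using that(2) by (auto intro!: derivative_eq_intros simp: field_simps)
  qed
  show ?thesis
    unfolding polygamma_gap_def
    by (intro DERIV_sum DERIV_diff scaled) (use assms arg_pos \<alpha> \<beta> in auto)
qed

lemma W_hat_pos: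
  assumes "0 < x"
  shows "0 < W_hat p a \<alpha> \<beta> x"
  unfolding W_hat_def
proof (rule prod_pos)
  fix j assume j: "j \<in> {1..p}"
  show "0 < Gamma (x / \<alpha> j + a) powr \<alpha> j / Gamma (x / \<beta> j + a) powr \<beta> j"
    using Gamma_real_pos[OF arg_pos(1)[OF _ j]] Gamma_real_pos[OF arg_pos(2)[OF _ j]] assms
    by (intro divide_pos_pos) (auto simp: less_imp_neq[symmetric])
qed

lemma V_hat_eq:
  assumes "0 < x"
  shows "V_hat p a \<alpha> \<beta> x = W_hat p a \<alpha> \<beta> x * exp (x * (\<Sum>j=1..p. ln (\<alpha> j) - ln (\<beta> j)))"
proof -
  have "exp (x * (\<Sum>j=1..p. ln (\<alpha> j) - ln (\<beta> j))) = (\<Prod>j=1..p. \<alpha> j powr x / \<beta> j powr x)"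
    unfolding sum_distrib_left exp_sum[OF finite_atLeastAtMost]
  proof (rule prod.cong[OF refl])
    fix j assume "j \<in> {1..p}"
    then show "exp (x * (ln (\<alpha> j) - ln (\<beta> j))) = \<alpha> j powr x / \<beta> j powr x"
      using \<alpha>[of j] \<beta>[of j] by (simp add: powr_def right_diff_distrib exp_diff)
  qed
  then show ?thesis
    by (simp add: V_hat_def W_hat_def flip: prod.distrib)
qed

lemma ln_W_hat:
  assumes "0 < x"
  shows "ln (W_hat p a \<alpha> \<beta> x) =
    (\<Sum>j=1..p. \<alpha> j * ln_Gamma (x / \<alpha> j + a) - \<beta> j * ln_Gamma (x / \<beta> j + a))"
proof -
  have G: "0 < Gamma (x / \<alpha> j + a)" "0 < Gamma (x / \<beta> j + a)" if "j \<in> {1..p}" for j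
    using arg_pos[of x j] assms that by (auto intro!: Gamma_real_pos)
  have "ln (W_hat p a \<alpha> \<beta> x) =
      (\<Sum>j=1..p. ln (Gamma (x / \<alpha> j + a) powr \<alpha> j / Gamma (x / \<beta> j + a) powr \<beta> j))"
    unfolding W_hat_def using G by (subst ln_prod) force+
  also have "\<dots> = (\<Sum>j=1..p. \<alpha> j * ln_Gamma (x / \<alpha> j + a) - \<beta> j * ln_Gamma (x / \<beta> j + a))"
  proof (rule sum.cong[OF refl])
    fix j assume j: "j \<in> {1..p}"
    show "ln (Gamma (x / \<alpha> j + a) powr \<alpha> j / Gamma (x / \<beta> j + a) powr \<beta> j) =
        \<alpha> j * ln_Gamma (x / \<alpha> j + a) - \<beta> j * ln_Gamma (x / \<beta> j + a)"
      using G[OF j] arg_pos[of x j] assms j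
      by (simp add: ln_divide_pos ln_powr ln_Gamma_real_pos less_imp_neq [symmetric])
  qed
  finally show ?thesis .
qed

lemma ln_W_hat_has_derivative:
  assumes x: "0 < x"
  shows "((\<lambda>x. ln (W_hat p a \<alpha> \<beta> x)) has_real_derivative polygamma_gap p a \<alpha> \<beta> 0 x) (at x)"
proof -
  have scaled: "((\<lambda>x. c * ln_Gamma (x / c + a)) has_real_derivative Digamma (x / c + a)) (at x)"
    if "0 < x / c + a" "0 < c" for c
    using that by (auto intro!: derivative_eq_intros)
  have "((\<lambda>x. \<Sum>j=1..p. \<alpha> j * ln_Gamma (x / \<alpha> j + a) - \<beta> j * ln_Gamma (x / \<beta> j + a))
      has_real_derivative
      (\<Sum>j=1..p. Digamma (x / \<alpha> j + a) - Digamma (x / \<beta> j + a))) (at x)"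
    by (intro DERIV_sum DERIV_diff scaled) (use x arg_pos[of x] \<alpha> \<beta> in auto)
  then have "((\<lambda>x. \<Sum>j=1..p. \<alpha> j * ln_Gamma (x / \<alpha> j + a) - \<beta> j * ln_Gamma (x / \<beta> j + a))
      has_real_derivative polygamma_gap p a \<alpha> \<beta> 0 x) (at x)"
    by (simp add: polygamma_gap_def)
  then show ?thesis
    by (rule has_field_derivative_transform_within_open[of _ _ _ "{0<..}"]) (use x ln_W_hat in auto)
qed

lemma ln_V_hat_has_derivative:
  assumes x: "0 < x"
  shows "((\<lambda>x. ln (V_hat p a \<alpha> \<beta> x)) has_real_derivative
    polygamma_gap p a \<alpha> \<beta> 0 x + (\<Sum>j=1..p. ln (\<alpha> j) - ln (\<beta> j))) (at x)"
proof -
  define C where "C = (\<Sum>j=1..p. ln (\<alpha> j) - ln (\<beta> j))"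
  have "((\<lambda>x. x * C) has_real_derivative C) (at x)"
    by (auto intro!: derivative_eq_intros)
  from DERIV_add[OF ln_W_hat_has_derivative[OF x] this]
  have "((\<lambda>x. ln (W_hat p a \<alpha> \<beta> x) + x * C) has_real_derivative
      polygamma_gap p a \<alpha> \<beta> 0 x + C) (at x)" .
  then show ?thesis
    unfolding C_def [symmetric]
  proof (rule has_field_derivative_transform_within_open[of _ _ _ "{0<..}"])
    fix y :: real assume "y \<in> {0<..}"
    then show "ln (W_hat p a \<alpha> \<beta> y) + y * C = ln (V_hat p a \<alpha> \<beta> y)"
      using W_hat_pos[of y] by (simp add: V_hat_eq C_def ln_mult_pos)
  qed (use x in auto)
qed

text \<open>The terms \<open>- ln x\<close> that the digamma asymptotics require cancel in the gap.\<close>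

lemma polygamma_gap_0_tendsto:
  "((\<lambda>x. polygamma_gap p a \<alpha> \<beta> 0 x + (\<Sum>j=1..p. ln (\<alpha> j) - ln (\<beta> j))) \<longlongrightarrow> 0) at_top"
proof -
  have "((\<lambda>x. \<Sum>j=1..p. (Digamma (x / \<alpha> j + a) + ln (\<alpha> j) - ln x) -
      (Digamma (x / \<beta> j + a) + ln (\<beta> j) - ln x)) \<longlongrightarrow> (\<Sum>j=1..p. 0 - 0)) at_top"
    by (intro tendsto_sum tendsto_diff Digamma_scaled_minus_ln_tendsto \<alpha> \<beta>)
  then show ?thesis
    by (simp add: polygamma_gap_def sum.distrib sum_subtractf algebra_simps)
qed

context
  assumes mono: "mono_on {1..p} \<beta>"
    and partial: "\<And>k. k \<in> {1..p} \<Longrightarrow> (\<Sum>j=1..k. \<alpha> j) \<le> (\<Sum>j=1..k. \<beta> j)"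
begin

lemma polygamma_gap_sign:
  assumes "1 \<le> n" "0 \<le> x"
  shows "0 \<le> (-1) ^ Suc n * polygamma_gap p a \<alpha> \<beta> n x"
  using sum_Polygamma_scaled_le[OF assms(1) a assms(2) \<alpha> \<beta> mono partial]
  by (simp add: polygamma_gap_def sum_subtractf sum_distrib_left right_diff_distrib)

lemma polygamma_gap_0_mono:
  assumes "0 \<le> x" "x \<le> y"
  shows "polygamma_gap p a \<alpha> \<beta> 0 x \<le> polygamma_gap p a \<alpha> \<beta> 0 y"
proof (rule DERIV_nonneg_imp_nondecreasing[OF assms(2)])
  fix z assume "x \<le> z"
  then have "0 \<le> z" using assms(1) by simp
  then show "\<exists>d. (polygamma_gap p a \<alpha> \<beta> 0 has_real_derivative d) (at z) \<and> 0 \<le> d"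
    using polygamma_gap_has_derivative[of z 0] polygamma_gap_sign[of 1 z] by auto
qed

lemma polygamma_gap_0_nonneg:
  assumes "0 \<le> x"
  shows "0 \<le> polygamma_gap p a \<alpha> \<beta> 0 x"
proof -
  \<comment> \<open>At \<open>0\<close> all digamma terms have the same argument \<open>a\<close>.\<close>
  have "polygamma_gap p a \<alpha> \<beta> 0 0 = 0" by (simp add: polygamma_gap_def)
  then show ?thesis using polygamma_gap_0_mono[of 0 x] assms by simp
qed

lemma polygamma_gap_0_le:
  assumes "0 \<le> x"
  shows "polygamma_gap p a \<alpha> \<beta> 0 x + (\<Sum>j=1..p. ln (\<alpha> j) - ln (\<beta> j)) \<le> 0"
proof (rule tendsto_lowerbound[OF polygamma_gap_0_tendsto])
  show "\<forall>\<^sub>F y in at_top. polygamma_gap p a \<alpha> \<beta> 0 x + (\<Sum>j=1..p. ln (\<alpha> j) - ln (\<beta> j)) \<le>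
      polygamma_gap p a \<alpha> \<beta> 0 y + (\<Sum>j=1..p. ln (\<alpha> j) - ln (\<beta> j))"
    using eventually_ge_at_top[of x] by eventually_elim (use polygamma_gap_0_mono assms in simp)
qed simp

lemma bernstein_function_deriv_ln_W_hat:
  "bernstein_function (deriv (\<lambda>x. ln (W_hat p a \<alpha> \<beta> x)))" (is "bernstein_function ?g")
proof -
  have g: "?g x = polygamma_gap p a \<alpha> \<beta> 0 x" if "0 < x" for x
    using DERIV_imp_deriv[OF ln_W_hat_has_derivative[OF that]] .
  have smooth: "smooth_on_pos ?g"
    by (rule smooth_on_posI[where F = "polygamma_gap p a \<alpha> \<beta>"])
      (use g polygamma_gap_has_derivative in auto)
  have "deriv ?g x = polygamma_gap p a \<alpha> \<beta> 1 x" if "0 < x" for x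
    using iterated_deriv_eqI(1)[of ?g "polygamma_gap p a \<alpha> \<beta>" x 1] g polygamma_gap_has_derivative that
    by simp
  then have "completely_monotonic (deriv ?g)"
    using polygamma_gap_has_derivative polygamma_gap_sign[where n = "Suc n" for n]
    by (intro completely_monotonicI[where F = "\<lambda>n. polygamma_gap p a \<alpha> \<beta> (Suc n)"]) auto
  with smooth show ?thesis
    unfolding bernstein_function_def using g polygamma_gap_0_nonneg by simp
qed

lemma log_completely_monotonic_V_hat: "log_completely_monotonic (V_hat p a \<alpha> \<beta>)"
proof -
  define C where "C = (\<Sum>j=1..p. ln (\<alpha> j) - ln (\<beta> j))"
  define F where "F n x = - polygamma_gap p a \<alpha> \<beta> n x - (if n = 0 then C else 0)" for n x
  have "completely_monotonic (\<lambda>x. - deriv (\<lambda>y. ln (V_hat p a \<alpha> \<beta> y)) x)"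
  proof (rule completely_monotonicI[where F = F])
    fix x :: real assume x: "0 < x"
    show "- deriv (\<lambda>y. ln (V_hat p a \<alpha> \<beta> y)) x = F 0 x"
      using DERIV_imp_deriv[OF ln_V_hat_has_derivative[OF x]] by (simp add: F_def C_def)
    fix n
    show "(F n has_real_derivative F (Suc n) x) (at x)"
      unfolding F_def using x by (auto intro!: derivative_eq_intros polygamma_gap_has_derivative)
    show "0 \<le> (-1) ^ n * F n x"
      using polygamma_gap_0_le[of x] polygamma_gap_sign[of n x] x
      by (cases "n = 0") (auto simp: F_def C_def)
  qed
  moreover have "(\<lambda>x. ln (V_hat p a \<alpha> \<beta> x)) differentiable_on {0<..}"
    by (rule differentiable_on_pos_realI) (rule ln_V_hat_has_derivative)
  ultimately show ?thesis
    unfolding log_completely_monotonic_def by (simp add: V_hat_eq W_hat_pos)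
qed

end

end

theorem theorem3p10:
  fixes p :: nat and a :: real and \<alpha> \<beta> :: "nat \<Rightarrow> real"
  assumes "1 \<le> p"
    and "1 \<le> a"
    and "0 < \<alpha> 1" and "mono_on {1..p} \<alpha>"
    and "0 < \<beta> 1" and "mono_on {1..p} \<beta>"
    and "\<forall>k\<in>{1..p}. (\<Sum>j=1..k. \<alpha> j) \<le> (\<Sum>j=1..k. \<beta> j)"
  shows "(\<forall>x>0. 0 < W_hat p a \<alpha> \<beta> x) \<and>
         (\<lambda>x. ln (W_hat p a \<alpha> \<beta> x)) differentiable_on {0<..} \<and>
         bernstein_function (deriv (\<lambda>x. ln (W_hat p a \<alpha> \<beta> x))) \<and>
         log_completely_monotonic (V_hat p a \<alpha> \<beta>)"
proof -
  have pos: "0 < \<gamma> j" if "0 < \<gamma> 1" "mono_on {1..p} \<gamma>" "j \<in> {1..p}" for \<gamma> :: "nat \<Rightarrow> real" and j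
    using mono_onD[OF that(2), of 1 j] that by auto
  have \<alpha>: "0 < \<alpha> j" and \<beta>: "0 < \<beta> j" if "j \<in> {1..p}" for j
    using pos that assms by blast+
  have partial: "(\<Sum>j=1..k. \<alpha> j) \<le> (\<Sum>j=1..k. \<beta> j)" if "k \<in> {1..p}" for k
    using assms(7) that by blast
  show ?thesis
  proof (intro conjI allI impI)
    show "0 < W_hat p a \<alpha> \<beta> x" if "0 < x" for x
      by (rule W_hat_pos) (use assms(2) \<alpha> \<beta> that in auto)
    show "(\<lambda>x. ln (W_hat p a \<alpha> \<beta> x)) differentiable_on {0<..}"
      by (rule differentiable_on_pos_realI, rule ln_W_hat_has_derivative) (use assms(2) \<alpha> \<beta> in auto)
    show "bernstein_function (deriv (\<lambda>x. ln (W_hat p a \<alpha> \<beta> x)))"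
      by (rule bernstein_function_deriv_ln_W_hat) (fact assms \<alpha> \<beta> partial)+
    show "log_completely_monotonic (V_hat p a \<alpha> \<beta>)"
      by (rule log_completely_monotonic_V_hat) (fact assms \<alpha> \<beta> partial)+
  qed
qed

end
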